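(* Let $a,b$ be positive integers and let $\lambda=(\lambda_1,\lambda_2,\dots)$ be a partition of $b$ (with $\lambda_i=0$ for $i>l(\lambda)$). Put $Y_0=0$, $Y_i=\sum_{j=1}^i\lambda_j$, and $$F_\lambda(q)=q^{2\sum_{i\geq 1}\binom{\lambda_i}{2}} \prod_{j\geq 1} \binom{j(a+2)-Y_{j-1}-Y_{j+1}}{\lambda_j-\lambda_{j+1}}_q .$$ Let $p$ be the number of distinct part sizes of $\lambda$, and let $d_1>d_2>\dots>d_p$ be the indices $d\ge1$ with $\lambda_d>\lambda_{d+1}$. Suppose that for each $j=1,\dots,p$ we are given a partition with distinct parts $\gamma^{d_j}=(\gamma^{d_j}_1,\gamma^{d_j}_2,\dots,\gamma^{d_j}_{\lambda_{d_j}-\lambda_{d_j+1}})$, i.e. a strictly decreasing sequence of nonnegative integers, such that $\gamma^{d_j}_{\lambda_{d_j}-\lambda_{d_j+1}}=0$ and $\gamma^{d_j}_1=-2+2Y_{d_j}/d_j$, and such that $$\sum_{j=1}^p\sum_{h} d_j\gamma^{d_j}_h=2\sum_{i\ge1}\binom{\lambda_i}{2}.$$ Then, for this fixed $p$-tuple $(\gamma^{d_1},\dots,\gamma^{d_p})$, $F_\lambda(q)$ is the generating function (by size) for all $p$-modular diagrams $\Theta$ of length $b$, contained inside an $a\times b$ rectangle, such that for each $j=1,\dots,p$, $\Theta$ has exactly $d_j(\lambda_{d_j}-\lambda_{d_j+1})$ rows labeled $j$, whose lengths $\Theta^j_1\ge\Theta^j_2\ge\dots\ge\Theta^j_{d_j(\lambda_{d_j}-\lambda_{d_j+1})}$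 satisfy: (1) $\Theta^j_{id_j+1}-\Theta^j_{d_j(i+1)}\le 1$ for all $i=0,1,\dots,\lambda_{d_j}-\lambda_{d_j+1}-1$; (2) $\Theta^j_{cd_j+h}-\Theta^j_{d_j(c+1)+h}\ge\gamma^{d_j}_{c+1}-\gamma^{d_j}_{c+2}$ for all $c=0,1,\dots,\lambda_{d_j}-\lambda_{d_j+1}-2$ and all $h=1,2,\dots,d_j$.
   Context: $\binom{n}{m}_q$ denotes the Gaussian polynomial ($q$-binomial coefficient). Modular diagrams (nonstandard definition): Fix a partition $\mu$ and positive integers $k\ge l(\mu)$ and $N$. An $N$-modular diagram of length $k$ consists of $k$ rows, the $i$-th row having length $\mu_i\ge 0$ (rows of length zero allowed), drawn as the Ferrers diagram of $\mu$ with a zeroth column of $k$ cells added on the left (so row $i$ has $\mu_i+1$ cells). Every cell is labeled with an integer between $1$ and $N$, every cell of a row other than its rightmost cell is labeled $N$, and labels in each column weakly decrease from top to bottom. A row is labeled $i$ if its rightmost cell (the zeroth cell if the row has length zero) is labeled $i$. The length of a row is $\mu_i$, and the size of the diagram is $\sum_i\mu_i$; generating functions count diagrams by $q^{\text{size}}$. The diagram is contained inside an $a\times b$ rectangle if it has length $b$ and all row lengths are at most $a$. *)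

theory Defs
  imports Complex_Main "HOL-Computational_Algebra.Polynomial" "HOL-Library.Groups_Big_Fun"
begin

section \<open>Gaussian polynomials\<close>

text \<open>\<open>qpoch n\<close> is \<open>(q;q)\<^sub>n\<close>, the variable \<open>q\<close> being the polynomial variable.\<close>

definition qpoch :: "nat \<Rightarrow> int poly" where
  "qpoch n = (\<Prod>i=1..n. 1 - monom 1 i)"

text \<open>
  The upper index of a Gaussian polynomial can be negative in the product below, so it is an
  integer; the usual convention applies that the polynomial vanishes unless
  \<open>0 \<le> m \<le> n\<close>.  The division is exact, see \<open>gauss_poly_exact\<close>.
\<close>

definition gauss_poly :: "int \<Rightarrow> nat \<Rightarrow> int poly" where
  "gauss_poly n m =
     (if int m \<le> n then qpoch (nat n) div (qpoch m * qpoch (nat n - m)) else 0)"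

lemma qpoch_0 [simp]: "qpoch 0 = 1"
  by (simp add: qpoch_def)

lemma qpoch_Suc: "qpoch (Suc n) = qpoch n * (1 - monom 1 (Suc n))"
  by (simp add: qpoch_def)

lemma qpoch_nonzero: "qpoch n \<noteq> 0"
proof -
  have "1 - monom (1::int) i \<noteq> 0" if "i \<ge> 1" for i
  proof
    assume "1 - monom (1::int) i = 0"
    then have "coeff (1 - monom (1::int) i) 0 = 0" by simp
    with that show False by simp
  qed
  then show ?thesis by (simp add: qpoch_def)
qed

lemma qpoch_dvd: "qpoch m * qpoch k dvd qpoch (m + k)"
proof (induction "m + k" arbitrary: m k)
  case 0
  then show ?case by simp
next
  case (Suc n)
  show ?case
  proof (cases "m = 0 \<or> k = 0")
    case True
    then show ?thesis by auto
  next
    case False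
    then obtain m' k' where mk: "m = Suc m'" "k = Suc k'"
      by (meson not0_implies_Suc)
    have n: "n = m' + k" "n = m + k'" using Suc(2) mk by simp_all
    have 1: "qpoch m * qpoch k dvd qpoch n * (1 - monom 1 m)"
      using mult_dvd_mono[OF Suc(1)[OF n(1)] dvd_refl[of "1 - monom 1 m"]] n(1) mk(1)
      by (simp add: qpoch_Suc mult_ac)
    have 2: "qpoch m * qpoch k dvd qpoch n * (1 - monom 1 k)"
      using mult_dvd_mono[OF Suc(1)[OF n(2)] dvd_refl[of "1 - monom 1 k"]] n(2) mk(2)
      by (simp add: qpoch_Suc mult_ac)
    have "monom (1::int) (Suc n) = monom 1 m * monom 1 k"
      by (simp add: mult_monom Suc(2))
    moreover have "qpoch (m + k) = qpoch n * (1 - monom 1 (Suc n))"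
      by (metis Suc(2) qpoch_Suc)
    ultimately have "qpoch (m + k) =
        qpoch n * (1 - monom 1 m) + monom 1 m * (qpoch n * (1 - monom 1 k))"
      by (simp add: algebra_simps)
    with 1 2 show ?thesis by (metis dvd_add dvd_mult)
  qed
qed

lemma gauss_poly_exact:
  "gauss_poly (int (m + k)) m * (qpoch m * qpoch k) = qpoch (m + k)"
proof -
  have "nat (int (m + k)) = m + k" by (rule nat_int)
  then show ?thesis using qpoch_dvd[of m k] by (simp only: gauss_poly_def) simp
qed

lemma gauss_poly_0: "n \<ge> 0 \<Longrightarrow> gauss_poly n 0 = 1"
  by (simp add: gauss_poly_def qpoch_nonzero)


section \<open>Partitions\<close>

text \<open>
  A partition is the list of its parts.  \<open>part xs i\<close> is the entry \<open>xs\<^sub>i\<close>, counted from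
  \<open>1\<close>, with \<open>xs\<^sub>i = 0\<close> beyond the end of the list.
\<close>

definition part :: "nat list \<Rightarrow> nat \<Rightarrow> nat" where
  "part xs i = (if 1 \<le> i \<and> i \<le> length xs then xs ! (i - 1) else 0)"

definition is_partition :: "nat list \<Rightarrow> nat \<Rightarrow> bool" where
  "is_partition lam b \<longleftrightarrow>
     sorted_wrt (\<ge>) lam \<and> (\<forall>x\<in>set lam. x > 0) \<and> sum_list lam = b"

definition Y :: "nat list \<Rightarrow> nat \<Rightarrow> nat" where
  "Y lam i = (\<Sum>j=1..i. part lam j)"

definition shift :: "nat list \<Rightarrow> nat" where
  "shift lam = 2 * (\<Sum>i=1..length lam. part lam i choose 2)"

definition F_factor :: "nat \<Rightarrow> nat list \<Rightarrow> nat \<Rightarrow> int poly" where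
  "F_factor a lam j =
     gauss_poly (int (j * (a + 2)) - int (Y lam (j - 1)) - int (Y lam (j + 1)))
       (part lam j - part lam (j + 1))"

text \<open>
  The product runs over all \<open>j \<ge> 1\<close>; only finitely many factors differ from \<open>1\<close>, see
  \<open>F_poly_finite_prod\<close>.
\<close>

definition F_poly :: "nat \<Rightarrow> nat list \<Rightarrow> int poly" where
  "F_poly a lam = monom 1 (shift lam) * (\<Prod>j. if 1 \<le> j then F_factor a lam j else 1)"

lemma Y_le: "Y lam i \<le> sum_list lam"
proof (cases "i \<le> length lam")
  case True
  have "Y lam i = (\<Sum>j=1..i. lam ! (j - 1))"
    unfolding Y_def using True by (intro sum.cong) (auto simp: part_def)
  also have "\<dots> = (\<Sum>j<i. lam ! j)"
    by (rule sum.reindex_bij_witness[of _ Suc "\<lambda>j. j - 1"]) auto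
  also have "\<dots> \<le> (\<Sum>j<length lam. lam ! j)"
    using True by (intro sum_mono2) auto
  also have "\<dots> = sum_list lam"
    by (simp add: sum_list_sum_nth atLeast0LessThan)
  finally show ?thesis .
next
  case False
  have "Y lam i = (\<Sum>j=1..length lam. part lam j)"
    unfolding Y_def using False by (intro sum.mono_neutral_right) (auto simp: part_def)
  also have "\<dots> = (\<Sum>j<length lam. lam ! j)"
    by (rule sum.reindex_bij_witness[of _ Suc "\<lambda>j. j - 1"]) (auto simp: part_def)
  also have "\<dots> = sum_list lam"
    by (simp add: sum_list_sum_nth atLeast0LessThan)
  finally show ?thesis by simp
qed

lemma F_factor_eq_1:
  assumes "is_partition lam b" and "j > b"
  shows "F_factor a lam j = 1"
proof -
  have "length lam \<le> sum_list lam"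
    using assms(1) sum_list_mono[of lam "\<lambda>_. 1" "\<lambda>x. x"]
    by (fastforce simp: is_partition_def sum_list_triv Suc_le_eq)
  then have part0: "part lam j - part lam (j + 1) = 0"
    using assms by (simp add: is_partition_def part_def)
  have "Y lam (j - 1) \<le> b" "Y lam (j + 1) \<le> b"
    using Y_le assms(1) by (auto simp: is_partition_def)
  moreover have "2 * b \<le> j * (a + 2)"
    using assms(2) by (simp add: algebra_simps trans_le_add2)
  ultimately have
    "0 \<le> int (j * (a + 2)) - int (Y lam (j - 1)) - int (Y lam (j + 1))"
    by linarith
  with part0 show ?thesis by (simp add: F_factor_def gauss_poly_0)
qed

lemma F_poly_finite_prod:
  assumes "is_partition lam b"
  shows "F_poly a lam = monom 1 (shift lam) * (\<Prod>j=1..b. F_factor a lam j)"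
proof -
  have "(\<Prod>j. if 1 \<le> j then F_factor a lam j else 1) =
      (\<Prod>j\<in>{1..b}. if 1 \<le> j then F_factor a lam j else 1)"
  proof (rule Prod_any.expand_superset)
    show "{j. (if 1 \<le> j then F_factor a lam j else 1) \<noteq> 1} \<subseteq> {1..b}"
      using F_factor_eq_1[OF assms, of _ a] by (auto split: if_splits) (metis not_le_imp_less)
  qed simp
  also have "\<dots> = (\<Prod>j=1..b. F_factor a lam j)"
    by (rule prod.cong) auto
  finally have "(\<Prod>j. if 1 \<le> j then F_factor a lam j else 1) = (\<Prod>j=1..b. F_factor a lam j)" .
  then show ?thesis by (simp add: F_poly_def)
qed

definition descents :: "nat list \<Rightarrow> nat set" where
  "descents lam = {d. 1 \<le> d \<and> part lam d > part lam (d + 1)}"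

text \<open>\<open>d_index lam j\<close> is the \<open>j\<close>-th largest element \<open>d\<^sub>j\<close> of \<open>descents lam\<close>, counted from \<open>1\<close>.\<close>

definition d_index :: "nat list \<Rightarrow> nat \<Rightarrow> nat" where
  "d_index lam j = part (rev (sorted_list_of_set (descents lam))) j"

definition mult_at :: "nat list \<Rightarrow> nat \<Rightarrow> nat" where
  "mult_at lam d = part lam d - part lam (d + 1)"


section \<open>Modular diagrams\<close>

text \<open>
  A diagram is the list of its rows from top to bottom, a row the list of the labels of its cells
  from left to right, starting with the cell in the zeroth column.
\<close>

type_synonym diagram = "nat list list"

definition row_length :: "nat list \<Rightarrow> nat" where
  "row_length r = length r - 1"

definition modular_diagram :: "nat \<Rightarrow> nat \<Rightarrow> diagram \<Rightarrow> bool" where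
  "modular_diagram N k D \<longleftrightarrow>
     length D = k \<and>
     (\<forall>r\<in>set D. r \<noteq> []) \<and>
     sorted_wrt (\<ge>) (map row_length D) \<and>
     (\<forall>r\<in>set D. \<forall>x\<in>set r. 1 \<le> x \<and> x \<le> N) \<and>
     (\<forall>r\<in>set D. \<forall>x\<in>set (butlast r). x = N) \<and>
     (\<forall>i i' c. i < i' \<and> i' < length D \<and> c < length (D ! i) \<and> c < length (D ! i')
        \<longrightarrow> D ! i ! c \<ge> D ! i' ! c)"

definition diagram_size :: "diagram \<Rightarrow> nat" where
  "diagram_size D = sum_list (map row_length D)"

definition inside_rectangle :: "nat \<Rightarrow> nat \<Rightarrow> diagram \<Rightarrow> bool" where
  "inside_rectangle a b D \<longleftrightarrow> length D = b \<and> (\<forall>r\<in>set D. row_length r \<le> a)"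

text \<open>
  The lengths of the rows labeled \<open>j\<close>; they come out in weakly decreasing order since the rows of
  a diagram are listed in that order.
\<close>

definition rows_labeled :: "diagram \<Rightarrow> nat \<Rightarrow> nat list" where
  "rows_labeled D j = map row_length (filter (\<lambda>r. last r = j) D)"

text \<open>
  The conditions on the rows with one label: \<open>T\<close> is the list of their lengths, \<open>g\<close> the associated
  partition with distinct parts, \<open>m\<close> its number of parts.  Differences are taken in the integers.
\<close>

definition row_conditions :: "nat \<Rightarrow> nat \<Rightarrow> nat list \<Rightarrow> nat list \<Rightarrow> bool" where
  "row_conditions d m g T \<longleftrightarrow>
     length T = d * m \<and>
     (\<forall>i. i < m \<longrightarrow> int (part T (i * d + 1)) - int (part T (d * (i + 1))) \<le> 1) \<and>
     (\<forall>c h. c + 2 \<le> m \<and> 1 \<le> h \<and> h \<le> d \<longrightarrow>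
        int (part T (c * d + h)) - int (part T (d * (c + 1) + h))
          \<ge> int (part g (c + 1)) - int (part g (c + 2)))"

definition admissible_diagrams ::
    "nat \<Rightarrow> nat \<Rightarrow> nat \<Rightarrow> nat list \<Rightarrow> (nat \<Rightarrow> nat list) \<Rightarrow> diagram set" where
  "admissible_diagrams a b p lam g =
     {D. modular_diagram p b D \<and> inside_rectangle a b D \<and>
         (\<forall>j\<in>{1..p}. row_conditions (d_index lam j) (mult_at lam (d_index lam j))
            (g (d_index lam j)) (rows_labeled D j))}"

text \<open>The generating function by size of a finite set of diagrams.\<close>

definition gen_fun :: "diagram set \<Rightarrow> int poly" where
  "gen_fun S = (\<Sum>D\<in>S. monom 1 (diagram_size D))"

end

theory Submission
  imports Defs "HOL-Library.FuncSet" "HOL-Library.Product_Lexorder" "HOL-Library.Multiset"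
begin

text \<open>
  A diagram is determined by the lengths of the rows carrying each label, and these can be chosen
  independently, so the generating function is a product over the labels.  For one label, with
  \<open>d = d\<^sub>j\<close>, the rows fall into blocks of \<open>d\<close>.  Subtracting \<open>\<gamma>\<^sub>c\<close> from the rows of block \<open>c\<close> leaves a
  block whose entries differ by at most 1, and such a block is determined by its sum \<open>S\<^sub>c\<close>.  The
  conditions on the rows say exactly that \<open>d (a - \<gamma>\<^sub>1) \<ge> S\<^sub>1 \<ge> S\<^sub>2 \<ge> \<dots> \<ge> 0\<close>; the requirement
  that the rows be sorted across blocks comes for free because \<open>\<gamma>\<close> is strictly decreasing.  Hence
  each label contributes a power of \<open>q\<close> times a Gaussian polynomial, whose upper index is the one
  in \<open>F_factor\<close> by the choice of \<open>\<gamma>\<^sub>1\<close>.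
\<close>

section \<open>Partitions in a box\<close>

definition box_partitions :: "nat \<Rightarrow> nat \<Rightarrow> nat list set" where
  "box_partitions m K = {S. length S = m \<and> sorted_wrt (\<ge>) S \<and> (\<forall>x\<in>set S. x \<le> K)}"

lemma finite_box_partitions [simp]: "finite (box_partitions m K)"
  by (rule finite_subset[OF _ finite_lists_length_eq[of "{..K}" m]])
     (auto simp: box_partitions_def)

definition box_poly :: "nat \<Rightarrow> nat \<Rightarrow> int poly" where
  "box_poly m K = (\<Sum>S\<in>box_partitions m K. monom 1 (sum_list S))"

lemma box_poly_0_left [simp]: "box_poly 0 K = 1"
proof -
  have "box_partitions 0 K = {[]}" by (auto simp: box_partitions_def)
  then show ?thesis by (simp add: box_poly_def)
qed

lemma box_poly_0_right [simp]: "box_poly m 0 = 1"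
proof -
  have "box_partitions m 0 = {replicate m 0}"
    by (auto simp: box_partitions_def sorted_wrt_iff_nth_less intro: replicate_eqI)
  then show ?thesis by (simp add: box_poly_def sum_list_replicate)
qed

lemma box_partitions_Suc_Suc:
  "box_partitions (Suc m) (Suc K) =
     (\<lambda>S. S @ [0]) ` box_partitions m (Suc K) \<union> map Suc ` box_partitions (Suc m) K"
proof (intro equalityI subsetI)
  fix S assume S: "S \<in> box_partitions (Suc m) (Suc K)"
  then obtain S' x where S': "S = S' @ [x]"
    by (cases S rule: rev_cases) (auto simp: box_partitions_def)
  show "S \<in> (\<lambda>S. S @ [0]) ` box_partitions m (Suc K) \<union> map Suc ` box_partitions (Suc m) K"
  proof (cases "x = 0")
    case True
    with S S' show ?thesis by (auto simp: box_partitions_def sorted_wrt_append)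
  next
    case False
    with S S' have pos: "\<forall>y\<in>set S. y > 0"
      by (auto simp: box_partitions_def sorted_wrt_append)
    have "S = map Suc (map (\<lambda>y. y - 1) S)"
      using pos by (simp add: map_idI)
    moreover have "map (\<lambda>y. y - 1) S \<in> box_partitions (Suc m) K"
      using S by (auto simp: box_partitions_def sorted_wrt_map le_diff_conv
          elim!: sorted_wrt_mono_rel[rotated])
    ultimately show ?thesis by blast
  qed
qed (auto simp: box_partitions_def sorted_wrt_append sorted_wrt_map)

text \<open>The q-Pascal recurrence. Raising each of the \<open>Suc m\<close> parts by 1 accounts
  for the factor \<open>monom 1 (Suc m)\<close>.\<close>

lemma box_poly_Suc_Suc:
  "box_poly (Suc m) (Suc K) = box_poly m (Suc K) + monom 1 (Suc m) * box_poly (Suc m) K"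
proof -
  have "box_poly (Suc m) (Suc K) =
      (\<Sum>S\<in>(\<lambda>S. S @ [0]) ` box_partitions m (Suc K). monom 1 (sum_list S)) +
      (\<Sum>S\<in>map Suc ` box_partitions (Suc m) K. monom 1 (sum_list S))"
    unfolding box_poly_def box_partitions_Suc_Suc
    by (rule sum.union_disjoint) (auto simp: append_eq_map_conv)
  also have "(\<Sum>S\<in>(\<lambda>S. S @ [0]) ` box_partitions m (Suc K). monom 1 (sum_list S)) =
      box_poly m (Suc K)"
    by (subst sum.reindex) (auto simp: box_poly_def inj_on_def)
  also have "(\<Sum>S\<in>map Suc ` box_partitions (Suc m) K. monom (1::int) (sum_list S)) =
      (\<Sum>S\<in>box_partitions (Suc m) K. monom 1 (Suc m) * monom 1 (sum_list S))"
    by (subst sum.reindex[OF inj_on_subset[OF inj_mapI[OF inj_Suc]]])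
       (auto simp: box_partitions_def mult_monom sum_list_Suc add_ac intro!: sum.cong)
  finally show ?thesis by (simp add: box_poly_def sum_distrib_left)
qed

text \<open>Clearing denominators keeps the induction inside the polynomial ring. Both neighbours in
  the recurrence yield the same smaller \<open>qpoch\<close>, with factors \<open>1 - q^m\<close>
  and \<open>1 - q^K\<close>, and
  \<open>(1 - q^m) + q^m * (1 - q^K) = 1 - q^(m + K)\<close>.\<close>

lemma box_poly_mult_qpoch: "box_poly m K * (qpoch m * qpoch K) = qpoch (m + K)"
proof (induction "m + K" arbitrary: m K rule: less_induct)
  case less
  show ?case
  proof (cases "m = 0 \<or> K = 0")
    case True
    then show ?thesis by auto
  next
    case False
    then obtain m' K' where mK: "m = Suc m'" "K = Suc K'" by (meson not0_implies_Suc)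
    let ?q = "\<lambda>n. monom (1::int) n"
    have "box_poly m' K * (qpoch m * qpoch K) =
        box_poly m' K * (qpoch m' * qpoch K) * (1 - ?q m)"
      unfolding mK qpoch_Suc[of m'] by (simp only: mult_ac)
    also have "box_poly m' K * (qpoch m' * qpoch K) = qpoch (Suc (m' + K'))"
      using less[of m' K] mK by simp
    finally have 1:
      "box_poly m' K * (qpoch m * qpoch K) = qpoch (Suc (m' + K')) * (1 - ?q m)" .
    have "box_poly m K' * (qpoch m * qpoch K) =
        box_poly m K' * (qpoch m * qpoch K') * (1 - ?q K)"
      unfolding mK qpoch_Suc[of K'] by (simp only: mult_ac)
    also have "box_poly m K' * (qpoch m * qpoch K') = qpoch (Suc (m' + K'))"
      using less[of m K'] mK by simp
    finally have 2:
      "box_poly m K' * (qpoch m * qpoch K) = qpoch (Suc (m' + K')) * (1 - ?q K)" .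
    have "box_poly m K * (qpoch m * qpoch K) =
        box_poly m' K * (qpoch m * qpoch K) + ?q m * (box_poly m K' * (qpoch m * qpoch K))"
      unfolding mK box_poly_Suc_Suc by (simp only: ring_distribs mult_ac)
    also have "\<dots> = qpoch (Suc (m' + K')) * (1 - ?q m) + ?q m * (qpoch (Suc (m' + K')) * (1 - ?q K))"
      by (simp only: 1 2)
    also have "\<dots> = qpoch (Suc (m' + K')) * (1 - ?q m * ?q K)"
      by (simp add: algebra_simps)
    also have "?q m * ?q K = ?q (Suc (Suc (m' + K')))"
      by (simp add: mult_monom mK)
    finally show ?thesis by (simp add: mK qpoch_Suc)
  qed
qed

lemma box_poly_eq_gauss_poly: "box_poly m K = gauss_poly (int K + int m) m"
proof -
  have "box_poly m K * (qpoch m * qpoch K) = gauss_poly (int (m + K)) m * (qpoch m * qpoch K)"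
    by (simp only: box_poly_mult_qpoch gauss_poly_exact)
  then show ?thesis by (simp add: qpoch_nonzero add.commute)
qed

section \<open>Balanced blocks\<close>

text \<open>
  The parts, indexed from 0 and weakly decreasing, of the partition of \<open>s\<close> into \<open>d\<close> nonnegative
  parts differing by at most 1.
\<close>

definition balanced_part :: "nat \<Rightarrow> nat \<Rightarrow> nat \<Rightarrow> nat" where
  "balanced_part d s h = (s + (d - Suc h)) div d"

lemma balanced_part_mono: "s \<le> t \<Longrightarrow> balanced_part d s h \<le> balanced_part d t h"
  by (simp add: balanced_part_def div_le_mono)

lemma balanced_part_antimono: "h \<le> h' \<Longrightarrow> balanced_part d s h' \<le> balanced_part d s h"
  by (simp add: balanced_part_def div_le_mono)

text \<open>Replacing \<open>h'\<close> by \<open>h\<close> raises the numerator by at most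
  \<open>d\<close>, hence the quotient by at most 1.\<close>

lemma balanced_part_spread:
  assumes "d > 0" "h' < d"
  shows "balanced_part d s h \<le> Suc (balanced_part d s h')"
proof -
  have "balanced_part d s h \<le> (s + (d - Suc h') + d) div d"
    unfolding balanced_part_def by (rule div_le_mono) simp
  also have "\<dots> = Suc (balanced_part d s h')"
    using assms(1) div_add_self2[of d "s + (d - Suc h')"] by (simp only: balanced_part_def Suc_eq_plus1)
  finally show ?thesis .
qed

lemma balanced_part_le:
  assumes "d > 0" "s \<le> d * K"
  shows "balanced_part d s h \<le> K"
proof -
  have "s + (d - Suc h) < d * Suc K"
    using assms by simp
  then show ?thesis
    unfolding balanced_part_def using less_mult_imp_div_less[of _ "Suc K" d]
    by (simp add: mult.commute less_Suc_eq_le)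
qed

text \<open>The explicit shape of a balanced block, by division with remainder. Its sum and its
  uniqueness are both read off from this form.\<close>

lemma balanced_part_add:
  assumes "k < d" "h < d"
  shows "balanced_part d (d * v + k) h = v + of_bool (h < k)"
proof -
  have "balanced_part d (d * v + k) h = v + (k + (d - Suc h)) div d"
    unfolding balanced_part_def add.assoc using assms by (simp only: div_mult_self4)
  \<comment> \<open>The numerator stays below \<open>2 * d\<close> and reaches \<open>d\<close>
    exactly when \<open>h < k\<close>.\<close>
  also have "(k + (d - Suc h)) div d = of_bool (h < k)"
  proof (cases "h < k")
    case True
    then have "k + (d - Suc h) = d + (k - Suc h)" "k - Suc h < d" using assms by simp_all
    then have "(k + (d - Suc h)) div d = 1" using assms by (simp only: div_add_self1) simp
    with True show ?thesis by simp
  next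
    case False
    then have "k + (d - Suc h) < d" using assms by simp
    with False show ?thesis by simp
  qed
  finally show ?thesis .
qed

lemma sum_of_bool_less:
  fixes k d v :: nat
  assumes "k \<le> d"
  shows "(\<Sum>i<d. v + of_bool (i < k)) = d * v + k"
proof -
  from assms have "{..<d} \<inter> {i. i < k} = {..<k}" by auto
  then show ?thesis by (simp add: sum.distrib of_bool_def sum.If_cases)
qed

lemma sum_balanced_part:
  assumes "d > 0"
  shows "(\<Sum>h<d. balanced_part d s h) = s"
proof -
  have "(\<Sum>h<d. balanced_part d s h) = (\<Sum>h<d. s div d + of_bool (h < s mod d))"
    using assms balanced_part_add[of "s mod d" d _ "s div d"] by simp
  also have "\<dots> = d * (s div d) + s mod d"
    using assms by (intro sum_of_bool_less) (simp add: less_imp_le)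
  finally show ?thesis by simp
qed

text \<open>Uniqueness of the balanced block with a given sum. The entries take only the values
  \<open>v\<close> (the last entry) and \<open>v + 1\<close>, and by monotonicity the larger value
  fills an initial segment of some length \<open>k\<close>. The sum \<open>d * v + k\<close> then
  determines \<open>v\<close> and \<open>k\<close>.\<close>

lemma balanced_part_eqI:
  assumes mono: "\<And>h h'. h \<le> h' \<Longrightarrow> h' < d \<Longrightarrow> u h' \<le> u h"
    and spread: "u 0 \<le> Suc (u (d - 1))" and h: "h < d"
  shows "balanced_part d (\<Sum>i<d. u i) h = u h"
proof -
  define v where "v = u (d - 1)"
  define k where "k = card {i. i < d \<and> u i > v}"
  have dich: "u i = v \<or> u i = Suc v" if "i < d" for i
    using mono[of 0 i] mono[of i "d - 1"] spread that unfolding v_def by linarith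
  \<comment> \<open>The last index is never counted, so \<open>k\<close> is a genuine remainder
    modulo \<open>d\<close>.\<close>
  have "k < d"
  proof -
    have "d - 1 \<in> {..<d} - {i. i < d \<and> u i > v}"
      using h by (simp add: v_def)
    then have "{i. i < d \<and> u i > v} \<subset> {..<d}" by blast
    then show ?thesis using psubset_card_mono[of "{..<d}"] by (simp add: k_def)
  qed
  have initial: "{i. i < d \<and> u i > v} = {..<k}"
  proof -
    have down: "i' \<in> {i. i < d \<and> u i > v}" if "i \<in> {i. i < d \<and> u i > v}" "i' \<le> i" for i i'
      using that mono[of i' i] by auto
    show ?thesis
    proof (intro equalityI subsetI)
      fix i assume "i \<in> {i. i < d \<and> u i > v}"
      then have "{..i} \<subseteq> {i. i < d \<and> u i > v}" using down by auto
      then have "card {..i} \<le> k" unfolding k_def by (rule card_mono[rotated]) simp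
      then show "i \<in> {..<k}" by simp
    next
      fix i assume i: "i \<in> {..<k}"
      show "i \<in> {i. i < d \<and> u i > v}"
      proof (rule ccontr)
        assume "i \<notin> {i. i < d \<and> u i > v}"
        then have "{i. i < d \<and> u i > v} \<subseteq> {..<i}" using down by (auto simp: not_le[symmetric])
        then have "k \<le> card {..<i}" unfolding k_def by (rule card_mono[rotated]) simp
        with i show False by simp
      qed
    qed
  qed
  have u: "u i = v + of_bool (i < k)" if "i < d" for i
  proof -
    have "i < k \<longleftrightarrow> u i > v" using initial that by blast
    then show ?thesis using dich[OF that] by auto
  qed
  have "(\<Sum>i<d. u i) = (\<Sum>i<d. v + of_bool (i < k))"
    using u by simp
  also have "\<dots> = d * v + k"
    using \<open>k < d\<close> by (intro sum_of_bool_less) simp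
  finally have "balanced_part d (\<Sum>i<d. u i) h = v + of_bool (h < k)"
    using balanced_part_add[OF \<open>k < d\<close> h] by simp
  then show ?thesis using u[OF h] by simp
qed

section \<open>Rows with a given label\<close>

definition label_rows :: "nat \<Rightarrow> nat \<Rightarrow> nat \<Rightarrow> nat list \<Rightarrow> nat list set" where
  "label_rows a d m g =
     {T. sorted_wrt (\<ge>) T \<and> (\<forall>x\<in>set T. x \<le> a) \<and> row_conditions d m g T}"

lemma finite_label_rows [simp]: "finite (label_rows a d m g)"
  by (rule finite_subset[OF _ finite_lists_length_eq[of "{..a}" "d * m"]])
     (auto simp: label_rows_def row_conditions_def)

lemma block_index_less:
  fixes c d h m :: nat
  assumes "c < m" "h < d"
  shows "c * d + h < d * m"
proof -
  have "c * d + h < Suc c * d" using \<open>h < d\<close> by simp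
  also have "\<dots> \<le> m * d" using \<open>c < m\<close> by (intro mult_right_mono) auto
  finally show ?thesis by (simp add: mult.commute)
qed

text \<open>Passes to indices from 0, where \<open>c * d + h\<close> with \<open>h < d\<close> is
  row \<open>h\<close> of block \<open>c\<close>, and moves terms across the inequalities so that no
  subtraction remains.\<close>

lemma row_conditions_iff:
  assumes "d > 0" "length g = m"
  shows "row_conditions d m g T \<longleftrightarrow>
    length T = d * m \<and>
    (\<forall>c<m. T ! (c * d) \<le> Suc (T ! (c * d + (d - 1)))) \<and>
    (\<forall>c h. Suc c < m \<and> h < d \<longrightarrow> T ! (Suc c * d + h) + g ! c \<le> T ! (c * d + h) + g ! Suc c)"
proof (cases "length T = d * m")
  case True
  have part: "part T (c * d + Suc h) = T ! (c * d + h)" if "c < m" "h < d" for c h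
    using block_index_less[OF that] True by (simp add: part_def)
  have part_g: "part g (Suc c) = g ! c" if "c < m" for c
    using that assms by (simp add: part_def)
  have 1: "int (part T (c * d + 1)) - int (part T (d * (c + 1))) \<le> 1 \<longleftrightarrow>
      T ! (c * d) \<le> Suc (T ! (c * d + (d - 1)))" if "c < m" for c
  proof -
    \<comment> \<open>Counted from 1, position \<open>d * (c + 1)\<close> is the last row of block
      \<open>c\<close>.\<close>
    have "d * (c + 1) = c * d + Suc (d - 1)" using assms by simp
    then have "part T (d * (c + 1)) = T ! (c * d + (d - 1))"
      using part[of c "d - 1"] that assms by (simp only:)
    with part[of c 0] that assms show ?thesis by simp linarith
  qed
  have 2: "int (part T (c * d + Suc h)) - int (part T (d * (c + 1) + Suc h))
          \<ge> int (part g (c + 1)) - int (part g (c + 2)) \<longleftrightarrow>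
      T ! (Suc c * d + h) + g ! c \<le> T ! (c * d + h) + g ! Suc c" if "Suc c < m" "h < d" for c h
  proof -
    have "d * (c + 1) = Suc c * d" "c + 1 = Suc c" "c + 2 = Suc (Suc c)" by simp_all
    then show ?thesis
      using part[of c h] part[of "Suc c" h] part_g[of c] part_g[of "Suc c"] that
      by (simp only:) linarith
  qed
  have "(\<forall>c h. c + 2 \<le> m \<and> 1 \<le> h \<and> h \<le> d \<longrightarrow> P c h) \<longleftrightarrow>
      (\<forall>c h. Suc c < m \<and> h < d \<longrightarrow> P c (Suc h))" for P
  proof (intro iffI allI impI)
    fix c h assume *: "\<forall>c h. Suc c < m \<and> h < d \<longrightarrow> P c (Suc h)" "c + 2 \<le> m \<and> 1 \<le> h \<and> h \<le> d"
    then have "Suc c < m \<and> h - 1 < d" "Suc (h - 1) = h" by auto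
    with *(1) show "P c h" by metis
  qed simp_all
  with 1 2 True show ?thesis unfolding row_conditions_def by simp
qed (simp add: row_conditions_def)

section \<open>The correspondence between the rows with one label and partitions in a box\<close>

definition rows_of_box :: "nat \<Rightarrow> nat \<Rightarrow> nat list \<Rightarrow> nat list \<Rightarrow> nat list" where
  "rows_of_box d m g S =
     map (\<lambda>i. g ! (i div d) + balanced_part d (S ! (i div d)) (i mod d)) [0..<d * m]"

text \<open>The truncated subtraction is exact for \<open>T\<close> in \<open>label_rows\<close>
  once the last entry of \<open>g\<close> is 0, see \<open>label_rows_ge\<close>.\<close>

definition box_of_rows :: "nat \<Rightarrow> nat \<Rightarrow> nat list \<Rightarrow> nat list \<Rightarrow> nat list" where
  "box_of_rows d m g T = map (\<lambda>c. \<Sum>h<d. T ! (c * d + h) - g ! c) [0..<m]"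

lemma length_rows_of_box [simp]: "length (rows_of_box d m g S) = d * m"
  by (simp add: rows_of_box_def)

lemma length_box_of_rows [simp]: "length (box_of_rows d m g T) = m"
  by (simp add: box_of_rows_def)

lemma nth_rows_of_box:
  assumes "c < m" "h < d"
  shows "rows_of_box d m g S ! (c * d + h) = g ! c + balanced_part d (S ! c) h"
  using assms block_index_less[OF assms] by (simp add: rows_of_box_def)

text \<open>Block \<open>c\<close> contributes \<open>d * g ! c\<close> from the shift and
  \<open>S ! c\<close> from its balanced part. So the correspondence changes the size by the
  constant \<open>d * sum_list g\<close>.\<close>

lemma sum_list_rows_of_box:
  assumes "d > 0" "length g = m" "length S = m"
  shows "sum_list (rows_of_box d m g S) = d * sum_list g + sum_list S"
proof -
  define f where "f i = rows_of_box d m g S ! i" for i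
  have "sum_list (rows_of_box d m g S) = sum f {..<m * d}"
    by (simp add: sum_list_sum_nth f_def atLeast0LessThan mult.commute)
  also have "\<dots> = (\<Sum>c<m. sum f {c * d..<c * d + d})"
    by (simp add: sum.nat_group)
  also have "\<dots> = (\<Sum>c<m. \<Sum>h<d. f (c * d + h))"
  proof (rule sum.cong[OF refl])
    fix c
    show "sum f {c * d..<c * d + d} = (\<Sum>h<d. f (c * d + h))"
      using sum.shift_bounds_nat_ivl[of f 0 "c * d" d] by (simp add: atLeast0LessThan add.commute)
  qed
  also have "\<dots> = (\<Sum>c<m. d * g ! c + S ! c)"
    using assms(1) by (intro sum.cong) (simp_all add: f_def nth_rows_of_box sum.distrib sum_balanced_part)
  also have "\<dots> = d * sum_list g + sum_list S"
    using assms by (simp add: sum.distrib sum_distrib_left[symmetric] sum_list_sum_nth atLeast0LessThan)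
  finally show ?thesis .
qed

text \<open>The bound \<open>a\<close> holds because the balanced entries are at most
  \<open>a - g ! 0\<close> and no \<open>g ! c\<close> exceeds \<open>g ! 0\<close>; the row
  conditions reduce to spread and monotonicity of balanced blocks.\<close>

lemma rows_of_box_in_label_rows:
  assumes "d > 0" "m > 0" "length g = m" "sorted_wrt (>) g" "g ! 0 \<le> a"
    and S: "S \<in> box_partitions m (d * (a - g ! 0))"
  shows "rows_of_box d m g S \<in> label_rows a d m g"
proof -
  let ?T = "rows_of_box d m g S"
  have S_mono: "S ! c' \<le> S ! c" if "c \<le> c'" "c' < m" for c c'
    using S that by (cases "c = c'") (auto simp: box_partitions_def sorted_wrt_iff_nth_less)
  have g_mono: "g ! c' < g ! c" if "c < c'" "c' < m" for c c'
    using assms(3,4) that by (auto simp: sorted_wrt_iff_nth_less)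
  have nth: "?T ! i = g ! (i div d) + balanced_part d (S ! (i div d)) (i mod d)"
    if "i < d * m" for i
    using that by (simp add: rows_of_box_def)
  have div: "i div d < m" if "i < d * m" for i
    using that by (simp add: less_mult_imp_div_less mult.commute)
  have sorted: "sorted_wrt (\<ge>) ?T"
    unfolding sorted_wrt_iff_nth_less
  proof (intro allI impI)
    fix i j assume ij: "i < j" "j < length ?T"
    define c h c' h' where ch: "c = i div d" "h = i mod d" "c' = j div d" "h' = j mod d"
    have c: "c \<le> c'" "c' < m" using ij div[of j] by (simp_all add: ch div_le_mono)
    have h: "h < d" "h' < d" using \<open>d > 0\<close> by (simp_all add: ch)
    show "?T ! j \<le> ?T ! i"
    proof (cases "c = c'")
      case True
      have "i = c * d + h" "j = c' * d + h'" by (simp_all add: ch)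
      then have "h \<le> h'" using True ij by simp
      then show ?thesis
        using ij True nth[of i] nth[of j] balanced_part_antimono[of h h' d "S ! c"]
        by (simp add: ch)
    next
      case False
      \<comment> \<open>Across blocks the balanced entry may grow, but by at most 1, and the strict
        decrease of \<open>g\<close> makes up for it.\<close>
      have "balanced_part d (S ! c') h' \<le> Suc (balanced_part d (S ! c') h)"
        using h by (intro balanced_part_spread) auto
      also have "balanced_part d (S ! c') h \<le> balanced_part d (S ! c) h"
        using c by (intro balanced_part_mono S_mono)
      finally show ?thesis using ij nth[of i] nth[of j] g_mono[of c c'] c False
        by (simp flip: ch)
    qed
  qed
  have le: "x \<le> a" if x: "x \<in> set ?T" for x
  proof -
    obtain i where i: "i < d * m" "x = ?T ! i"
      using x unfolding in_set_conv_nth length_rows_of_box by blast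
    have "S ! (i div d) \<le> d * (a - g ! 0)"
      using S div[OF i(1)] by (auto simp: box_partitions_def)
    then have "balanced_part d (S ! (i div d)) (i mod d) \<le> a - g ! 0"
      using \<open>d > 0\<close> by (rule balanced_part_le[rotated])
    moreover have "g ! (i div d) \<le> g ! 0"
      using g_mono[of 0 "i div d"] div[OF i(1)] by (cases "i div d = 0") auto
    ultimately show ?thesis using i nth \<open>g ! 0 \<le> a\<close> by simp
  qed
  have "?T ! (c * d) \<le> Suc (?T ! (c * d + (d - 1)))" if "c < m" for c
    using nth_rows_of_box[of c m 0 d g S] nth_rows_of_box[of c m "d - 1" d g S] that \<open>d > 0\<close>
      balanced_part_spread[of d "d - 1" "S ! c" 0] by simp
  moreover have "?T ! (Suc c * d + h) + g ! c \<le> ?T ! (c * d + h) + g ! Suc c"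
    if "Suc c < m" "h < d" for c h
    using nth_rows_of_box[of c m h d g S] nth_rows_of_box[of "Suc c" m h d g S] that
      balanced_part_mono[OF S_mono[of c "Suc c"], of d h] by simp
  ultimately have "row_conditions d m g ?T"
    using assms by (simp add: row_conditions_iff)
  with sorted le show ?thesis by (simp add: label_rows_def)
qed

lemma box_of_rows_of_box:
  assumes "d > 0" "length S = m"
  shows "box_of_rows d m g (rows_of_box d m g S) = S"
  using assms by (intro nth_equalityI) (simp_all add: box_of_rows_def nth_rows_of_box sum_balanced_part)

context
  fixes a d m :: nat and g T :: "nat list"
  assumes d: "d > 0" and m: "m > 0" and g: "length g = m" "g ! (m - 1) = 0"
    and T: "T \<in> label_rows a d m g"
begin

lemma label_rows_nth:
  shows "\<And>c. c < m \<Longrightarrow> T ! (c * d) \<le> Suc (T ! (c * d + (d - 1)))"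
    and "\<And>c h. Suc c < m \<Longrightarrow> h < d \<Longrightarrow> T ! (Suc c * d + h) + g ! c \<le> T ! (c * d + h) + g ! Suc c"
    and "length T = d * m"
  using T d g by (auto simp: label_rows_def row_conditions_iff)

text \<open>Induction from the last block backwards: there \<open>g\<close> is 0, and the second row
  condition carries the inequality from block \<open>Suc c\<close> to block
  \<open>c\<close>.\<close>

lemma label_rows_ge: "c < m \<Longrightarrow> h < d \<Longrightarrow> g ! c \<le> T ! (c * d + h)"
proof (induction "m - c" arbitrary: c)
  case (Suc n)
  show ?case
  proof (cases "Suc c < m")
    case True
    with Suc(1)[of "Suc c"] Suc(2-) have "g ! Suc c \<le> T ! (Suc c * d + h)" by simp
    with label_rows_nth(2)[OF True \<open>h < d\<close>] show ?thesis by simp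
  next
    case False
    with Suc have "c = m - 1" by simp
    with g show ?thesis by simp
  qed
qed simp

text \<open>Since the subtractions are exact, this is the second row condition chained over
  consecutive blocks.\<close>

lemma label_rows_diff_antimono:
  assumes "c \<le> c'" "c' < m" "h < d"
  shows "T ! (c' * d + h) - g ! c' \<le> T ! (c * d + h) - g ! c"
  using assms
proof (induction c' rule: dec_induct)
  case (step n)
  then show ?case using label_rows_nth(2)[of n h] label_rows_ge[of n h] label_rows_ge[of "Suc n" h]
    by simp
qed simp

lemma box_of_rows_in_box_partitions: "box_of_rows d m g T \<in> box_partitions m (d * (a - g ! 0))"
proof -
  have nth: "box_of_rows d m g T ! c = (\<Sum>h<d. T ! (c * d + h) - g ! c)" if "c < m" for c
    using that by (simp add: box_of_rows_def)
  have anti: "box_of_rows d m g T ! c' \<le> box_of_rows d m g T ! c" if "c \<le> c'" "c' < m" for c c'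
    using that nth[of c] nth[of c'] label_rows_diff_antimono[of c c'] by (auto intro: sum_mono)
  \<comment> \<open>Only the first entry needs an estimate, since the entries decrease.\<close>
  have "box_of_rows d m g T ! 0 \<le> (\<Sum>h<d. a - g ! 0)"
    unfolding nth[OF m]
  proof (rule sum_mono)
    fix h assume "h \<in> {..<d}"
    then have "T ! h \<in> set T"
      using block_index_less[of 0 m h d] m label_rows_nth(3) by simp
    then have "T ! h \<le> a" using T by (auto simp: label_rows_def)
    then show "T ! (0 * d + h) - g ! 0 \<le> a - g ! 0" by (simp add: diff_le_mono)
  qed
  then have "box_of_rows d m g T ! c \<le> d * (a - g ! 0)" if "c < m" for c
    using anti[of 0 c] that by simp
  with anti show ?thesis
    by (auto simp: box_partitions_def sorted_wrt_iff_nth_less in_set_conv_nth)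
qed

text \<open>Subtracting the constant \<open>g ! c\<close> from a block keeps it weakly decreasing
  with spread at most 1, so its sum recovers it by \<open>balanced_part_eqI\<close>.\<close>

lemma rows_of_box_of_rows: "rows_of_box d m g (box_of_rows d m g T) = T"
proof (rule nth_equalityI)
  fix i assume "i < length (rows_of_box d m g (box_of_rows d m g T))"
  then have i: "i < d * m" by simp
  define c h where ch: "c = i div d" "h = i mod d"
  have c: "c < m" using i by (simp add: ch less_mult_imp_div_less mult.commute)
  have h: "h < d" using d by (simp add: ch)
  let ?u = "\<lambda>h. T ! (c * d + h) - g ! c"
  have "balanced_part d (\<Sum>h<d. ?u h) h = ?u h"
  proof (rule balanced_part_eqI)
    show "?u h'' \<le> ?u h'" if "h' \<le> h''" "h'' < d" for h' h''
    proof -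
      have "T ! (c * d + h'') \<le> T ! (c * d + h')"
        using T that label_rows_nth(3) block_index_less[OF c that(2)]
        by (cases "h' = h''") (auto simp: label_rows_def sorted_wrt_iff_nth_less)
      then show ?thesis by (rule diff_le_mono)
    qed
    show "?u 0 \<le> Suc (?u (d - 1))"
      using label_rows_nth(1)[OF c] by simp
  qed (use h in simp)
  moreover have "rows_of_box d m g (box_of_rows d m g T) ! i =
      g ! c + balanced_part d (\<Sum>h<d. ?u h) h"
    using i c by (simp add: rows_of_box_def box_of_rows_def flip: ch)
  moreover have "i = c * d + h" by (simp add: ch)
  ultimately show "rows_of_box d m g (box_of_rows d m g T) ! i = T ! i"
    using label_rows_ge[OF c h] by simp
qed (simp add: label_rows_nth(3))

end

text \<open>The integer upper index covers both cases at once: for \<open>g ! 0 \<le> a\<close> the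
  correspondence applies, with box height \<open>d * (a - g ! 0)\<close>, and otherwise both sides
  vanish.\<close>

lemma label_rows_generating_function:
  assumes "d > 0" "m > 0" "length g = m" "sorted_wrt (>) g" "g ! (m - 1) = 0"
  shows "(\<Sum>T\<in>label_rows a d m g. monom (1::int) (sum_list T)) =
    monom 1 (d * sum_list g) * gauss_poly (int d * (int a - int (g ! 0)) + int m) m"
proof (cases "g ! 0 \<le> a")
  case True
  have "(\<Sum>T\<in>label_rows a d m g. monom (1::int) (sum_list T)) =
      (\<Sum>S\<in>box_partitions m (d * (a - g ! 0)). monom 1 (d * sum_list g + sum_list S))"
  proof (rule sum.reindex_bij_witness[of _ "rows_of_box d m g" "box_of_rows d m g"])
    fix T assume T: "T \<in> label_rows a d m g"
    show eq: "rows_of_box d m g (box_of_rows d m g T) = T"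
      using rows_of_box_of_rows[OF assms(1,2,3,5) T] .
    show "box_of_rows d m g T \<in> box_partitions m (d * (a - g ! 0))"
      using box_of_rows_in_box_partitions[OF assms(1,2,3,5) T] .
    show "monom (1::int) (d * sum_list g + sum_list (box_of_rows d m g T)) = monom 1 (sum_list T)"
      using sum_list_rows_of_box[OF assms(1,3), of "box_of_rows d m g T"] eq by simp
  next
    fix S assume S: "S \<in> box_partitions m (d * (a - g ! 0))"
    then show "box_of_rows d m g (rows_of_box d m g S) = S"
      using assms(1) by (intro box_of_rows_of_box) (auto simp: box_partitions_def)
    show "rows_of_box d m g S \<in> label_rows a d m g"
      using rows_of_box_in_label_rows[OF assms(1-4) True S] .
  qed
  also have "\<dots> = monom 1 (d * sum_list g) * box_poly m (d * (a - g ! 0))"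
    by (simp add: box_poly_def sum_distrib_left mult_monom)
  also have "box_poly m (d * (a - g ! 0)) =
      gauss_poly (int d * (int a - int (g ! 0)) + int m) m"
    using True by (simp add: box_poly_eq_gauss_poly of_nat_diff)
  finally show ?thesis .
next
  case False
  \<comment> \<open>The first row would be at least \<open>g ! 0 > a\<close>. On the other side the
    upper index falls below \<open>m\<close>, where \<open>gauss_poly\<close> is 0 by
    convention.\<close>
  have "label_rows a d m g = {}"
  proof (rule equals0I)
    fix T assume T: "T \<in> label_rows a d m g"
    have "g ! 0 \<le> T ! 0"
      using label_rows_ge[OF assms(1,2,3,5) T, of 0 0] assms by simp
    moreover have "T ! 0 \<in> set T"
      using label_rows_nth(3)[OF assms(1,2,3,5) T] assms by simp
    ultimately show False using T False by (fastforce simp: label_rows_def)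
  qed
  moreover have "int d * (int a - int (g ! 0)) < 0"
    using False assms(1) by (simp add: mult_pos_neg)
  ultimately show ?thesis by (simp add: gauss_poly_def)
qed

section \<open>Diagrams as families of row lengths\<close>

text \<open>A row is encoded by its length and its label, in this order, so that the lexicographic
  order on pairs compares lengths first.\<close>

definition diagram_row :: "nat \<Rightarrow> nat \<times> nat \<Rightarrow> nat list" where
  "diagram_row p x = replicate (fst x) p @ [snd x]"

lemma row_length_diagram_row [simp]: "row_length (diagram_row p x) = fst x"
  by (simp add: diagram_row_def row_length_def)

lemma last_diagram_row [simp]: "last (diagram_row p x) = snd x"
  by (simp add: diagram_row_def)

lemma diagram_row_nth:
  "c \<le> fst x \<Longrightarrow> diagram_row p x ! c = (if c < fst x then p else snd x)"
  by (simp add: diagram_row_def nth_append)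

text \<open>A cell that is not the last of its row carries the maximal label \<open>p\<close>, so
  the column condition can fail only at the last cell of the upper row. A lower row reaching that
  column has the same length. The two order conditions thus amount to lexicographic decrease of the
  pairs.\<close>

lemma modular_diagram_iff:
  "modular_diagram p k D \<longleftrightarrow>
    (\<exists>L. D = map (diagram_row p) L \<and> length L = k \<and> sorted_wrt (\<ge>) L \<and>
         (\<forall>x\<in>set L. 1 \<le> snd x \<and> snd x \<le> p))"
proof
  assume D: "modular_diagram p k D"
  define L where "L = map (\<lambda>r. (row_length r, last r)) D"
  have row: "diagram_row p (row_length r, last r) = r" if "r \<in> set D" for r
  proof -
    have "butlast r = replicate (row_length r) p"
      using D that by (intro replicate_eqI) (auto simp: modular_diagram_def row_length_def)
    moreover have "r \<noteq> []" using D that by (simp add: modular_diagram_def)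
    ultimately show ?thesis by (metis append_butlast_last_id diagram_row_def fst_conv snd_conv)
  qed
  have "D = map (diagram_row p) L"
    using row by (simp add: L_def map_idI)
  moreover have "length L = k" using D by (simp add: L_def modular_diagram_def)
  moreover have "\<forall>x\<in>set L. 1 \<le> snd x \<and> snd x \<le> p"
    using D by (auto simp: L_def modular_diagram_def)
  moreover have "sorted_wrt (\<ge>) L"
    unfolding sorted_wrt_iff_nth_less
  proof (intro allI impI)
    fix i j assume ij: "i < j" "j < length L"
    then have len: "row_length (D ! j) \<le> row_length (D ! i)"
      using D by (auto simp: L_def modular_diagram_def sorted_wrt_iff_nth_less)
    \<comment> \<open>Rows of equal length end in the same column, where the column condition
      compares their labels.\<close>
    have "last (D ! j) \<le> last (D ! i)" if eq: "row_length (D ! i) = row_length (D ! j)"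
    proof -
      have ne: "D ! i \<noteq> []" "D ! j \<noteq> []" using D ij by (auto simp: L_def modular_diagram_def)
      have "D ! j ! row_length (D ! j) \<le> D ! i ! row_length (D ! j)"
      proof -
        have "row_length (D ! j) < length (D ! i)" "row_length (D ! j) < length (D ! j)"
          using ne eq by (cases "D ! i"; cases "D ! j"; simp add: row_length_def)+
        with D ij show ?thesis by (simp add: L_def modular_diagram_def)
      qed
      then show ?thesis using ne eq by (simp add: last_conv_nth row_length_def)
    qed
    with len show "L ! j \<le> L ! i" using ij unfolding le_less[of "row_length _"]
      by (auto simp: L_def less_eq_prod_def)
  qed
  ultimately show "\<exists>L. D = map (diagram_row p) L \<and> length L = k \<and> sorted_wrt (\<ge>) L \<and>
         (\<forall>x\<in>set L. 1 \<le> snd x \<and> snd x \<le> p)" by blast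
next
  assume "\<exists>L. D = map (diagram_row p) L \<and> length L = k \<and> sorted_wrt (\<ge>) L \<and>
         (\<forall>x\<in>set L. 1 \<le> snd x \<and> snd x \<le> p)"
  then obtain L where L: "D = map (diagram_row p) L" "length L = k" "sorted_wrt (\<ge>) L"
    "\<forall>x\<in>set L. 1 \<le> snd x \<and> snd x \<le> p" by blast
  have le: "L ! j \<le> L ! i" if "i < j" "j < length L" for i j
    using L(3) that by (auto simp: sorted_wrt_iff_nth_less)
  have label: "1 \<le> x \<and> x \<le> p" if "r \<in> set D" "x \<in> set r" for r x
    using L that by (fastforce simp: diagram_row_def split: if_splits)
  have "D ! i ! c \<ge> D ! j ! c"
    if c: "i < j" "j < length D" "c < length (D ! i)" "c < length (D ! j)" for i j c
  proof -
    have len: "c \<le> fst (L ! i)" "c \<le> fst (L ! j)" "j < length L" "i < length L"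
      using c L(1) by (auto simp: diagram_row_def)
    show ?thesis
    proof (cases "c < fst (L ! i)")
      case True
      then have "D ! i ! c = p" using len L(1) by (simp add: diagram_row_nth)
      moreover have "D ! j ! c \<le> p" using c(2,4) label[of "D ! j" "D ! j ! c"] by simp
      ultimately show ?thesis by simp
    next
      case False
      \<comment> \<open>The upper row ends in column \<open>c\<close>; the lower row reaches
        \<open>c\<close> without being longer, so it ends there too.\<close>
      with len le[OF c(1)] have "fst (L ! i) = c" "fst (L ! j) = c" "snd (L ! j) \<le> snd (L ! i)"
        by (auto simp: less_eq_prod_def)
      then show ?thesis using len L(1) by (simp add: diagram_row_nth)
    qed
  qed
  moreover have "sorted_wrt (\<ge>) (map row_length D)"
    using L(1,3) by (auto simp: sorted_wrt_map less_eq_prod_def elim!: sorted_wrt_mono_rel[rotated])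
  ultimately show "modular_diagram p k D"
    using L(1,2) label by (auto simp: modular_diagram_def diagram_row_def)
qed

section \<open>Splitting rows by label and merging them again\<close>

definition with_label :: "nat \<Rightarrow> (nat \<times> nat) list \<Rightarrow> nat list" where
  "with_label j L = map fst (filter (\<lambda>x. snd x = j) L)"

lemma rows_labeled_diagram: "rows_labeled (map (diagram_row p) L) j = with_label j L"
  by (simp add: rows_labeled_def with_label_def filter_map o_def)

lemma diagram_size_diagram: "diagram_size (map (diagram_row p) L) = sum_list (map fst L)"
  by (simp add: diagram_size_def o_def)

lemma sum_list_with_label:
  "\<forall>x\<in>set L. 1 \<le> snd x \<and> snd x \<le> p \<Longrightarrow>
    (\<Sum>j=1..p. sum_list (with_label j L)) = sum_list (map fst L)"
proof (induction L)
  case (Cons x L)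
  have "(\<Sum>j=1..p. sum_list (with_label j (x # L))) =
      (\<Sum>j=1..p. (if snd x = j then fst x else 0) + sum_list (with_label j L))"
    by (intro sum.cong) (simp_all add: with_label_def)
  also have "\<dots> = fst x + sum_list (map fst L)"
    using Cons by (simp only: sum.distrib) simp
  finally show ?case by simp
qed (simp add: with_label_def)

lemma length_with_label:
  "\<forall>x\<in>set L. 1 \<le> snd x \<and> snd x \<le> p \<Longrightarrow> (\<Sum>j=1..p. length (with_label j L)) = length L"
proof (induction L)
  case (Cons x L)
  have "(\<Sum>j=1..p. length (with_label j (x # L))) =
      (\<Sum>j=1..p. (if snd x = j then 1 else 0) + length (with_label j L))"
    by (intro sum.cong) (simp_all add: with_label_def)
  also have "\<dots> = 1 + length L"
    using Cons by (simp only: sum.distrib) simp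
  finally show ?case by simp
qed (simp add: with_label_def)

lemma count_mset_pairs: "count (mset L) (n, j) = count (mset (with_label j L)) n"
  by (induction L) (auto simp: with_label_def)

text \<open>The multiplicity of \<open>(n, j)\<close> can be read off from
  \<open>with_label j\<close>, and a sorted list is determined by its multiset. Reversal adapts
  decreasing lists to \<open>sort\<close>, which is increasing.\<close>

lemma sorted_pairs_eqI:
  assumes "sorted_wrt (\<ge>) L" "sorted_wrt (\<ge>) L'" "\<And>j. with_label j L = with_label j L'"
  shows "L = L'"
proof -
  have "mset L = mset L'"
    using assms(3) by (intro multiset_eqI) (auto simp: count_mset_pairs)
  moreover have "sorted (rev L)" "sorted (rev L')"
    using assms(1,2) by (simp_all add: sorted_wrt_rev)
  ultimately have "sort (rev L) = rev L'" "sort (rev L) = rev L"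
    by (auto intro: properties_for_sort sorted_sort_id)
  then show ?thesis by (simp only: rev_is_rev_conv)
qed

definition merge_rows :: "nat \<Rightarrow> (nat \<Rightarrow> nat list) \<Rightarrow> (nat \<times> nat) list" where
  "merge_rows p T = rev (sort (concat (map (\<lambda>j. map (\<lambda>n. (n, j)) (T j)) [1..<Suc p])))"

lemma set_merge_rows: "set (merge_rows p T) = {(n, j). j \<in> {1..p} \<and> n \<in> set (T j)}"
  by (auto simp: merge_rows_def)

lemma sorted_merge_rows: "sorted_wrt (\<ge>) (merge_rows p T)"
  by (simp add: merge_rows_def sorted_wrt_rev)

lemma with_label_concat:
  "with_label j (concat (map (\<lambda>j. map (\<lambda>n. (n, j)) (T j)) [1..<Suc p])) =
     (if j \<in> {1..p} then T j else [])"
proof (induction p)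
  case (Suc p)
  have "with_label j (xs @ ys) = with_label j xs @ with_label j ys" for xs ys
    by (simp add: with_label_def)
  moreover have "with_label j (map (\<lambda>n. (n, i)) ys) = (if i = j then ys else [])" for i ys
    by (simp add: with_label_def filter_map o_def)
  ultimately show ?case using Suc by auto
qed (simp add: with_label_def)

text \<open>Sorting preserves multiplicities, so both sides have the same multiset, and both are
  weakly decreasing.\<close>

lemma with_label_merge_rows:
  assumes "j \<in> {1..p}" "sorted_wrt (\<ge>) (T j)"
  shows "with_label j (merge_rows p T) = T j"
proof -
  let ?X = "concat (map (\<lambda>j. map (\<lambda>n. (n, j)) (T j)) [1..<Suc p])"
  have "mset (with_label j (merge_rows p T)) = mset (with_label j ?X)"
    unfolding with_label_def merge_rows_def mset_map mset_filter mset_rev mset_sort ..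
  then have "mset (with_label j (merge_rows p T)) = mset (T j)"
    using assms(1) by (simp only: with_label_concat) simp
  moreover have "sorted_wrt (\<ge>) (filter (\<lambda>x. snd x = j) (merge_rows p T))"
    using sorted_merge_rows by (rule sorted_wrt_filter)
  then have "sorted_wrt (\<ge>) (with_label j (merge_rows p T))"
    unfolding with_label_def sorted_wrt_map
    by (rule sorted_wrt_mono_rel[rotated]) (auto simp: less_eq_prod_def)
  ultimately have "rev (with_label j (merge_rows p T)) = rev (T j)"
    using assms(2) properties_for_sort[of "rev (T j)" "rev (T j)"]
      properties_for_sort[of "rev (with_label j (merge_rows p T))" "rev (T j)"]
    by (simp add: sorted_wrt_rev)
  then show ?thesis by simp
qed

text \<open>
  Two rows with different labels impose no condition on each other, so a diagram amounts to an
  arbitrary choice, for each label, of the lengths of the rows carrying it.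
\<close>

lemma bij_betw_rows_labeled:
  fixes P :: "nat \<Rightarrow> nat list \<Rightarrow> bool"
  assumes len: "\<And>j T. j \<in> {1..p} \<Longrightarrow> P j T \<Longrightarrow> length T = n j"
    and b: "(\<Sum>j=1..p. n j) = b"
  shows "bij_betw (\<lambda>D. \<lambda>j\<in>{1..p}. rows_labeled D j)
    {D. modular_diagram p b D \<and> inside_rectangle a b D \<and> (\<forall>j\<in>{1..p}. P j (rows_labeled D j))}
    (\<Pi>\<^sub>E j\<in>{1..p}. {T. sorted_wrt (\<ge>) T \<and> (\<forall>x\<in>set T. x \<le> a) \<and> P j T})"
    (is "bij_betw ?f ?A ?B")
proof (rule bij_betw_imageI)
  show "inj_on ?f ?A"
  proof (rule inj_onI)
    fix D D' assume D: "D \<in> ?A" and D': "D' \<in> ?A" and eq: "?f D = ?f D'"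
    from D obtain L where L: "D = map (diagram_row p) L" "sorted_wrt (\<ge>) L"
      "\<forall>x\<in>set L. 1 \<le> snd x \<and> snd x \<le> p" by (auto simp: modular_diagram_iff)
    from D' obtain L' where L': "D' = map (diagram_row p) L'" "sorted_wrt (\<ge>) L'"
      "\<forall>x\<in>set L'. 1 \<le> snd x \<and> snd x \<le> p" by (auto simp: modular_diagram_iff)
    have "with_label j L = with_label j L'" for j
    proof (cases "j \<in> {1..p}")
      case True
      then show ?thesis using fun_cong[OF eq, of j] by (simp add: L L' rows_labeled_diagram)
    next
      case False
      \<comment> \<open>Labels outside \<open>{1..p}\<close> do not occur, so restricting to
        \<open>{1..p}\<close> loses no row.\<close>
      then have "filter (\<lambda>x. snd x = j) L = []" "filter (\<lambda>x. snd x = j) L' = []"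
        using L(3) L'(3) by (auto simp: filter_empty_conv)
      then show ?thesis by (simp add: with_label_def)
    qed
    then have "L = L'" using L(2) L'(2) by (intro sorted_pairs_eqI)
    then show "D = D'" by (simp add: L L')
  qed
  show "?f ` ?A = ?B"
  proof (intro equalityI subsetI)
    fix f assume "f \<in> ?f ` ?A"
    then obtain D where D: "D \<in> ?A" "f = ?f D" by blast
    have "sorted_wrt (\<ge>) (rows_labeled D j)" for j
      using D(1) by (auto simp: modular_diagram_def rows_labeled_def sorted_wrt_map
          intro: sorted_wrt_filter)
    moreover have "x \<le> a" if "x \<in> set (rows_labeled D j)" for x j
      using D(1) that by (auto simp: inside_rectangle_def rows_labeled_def)
    ultimately show "f \<in> ?B" using D by auto
  next
    fix T assume T: "T \<in> ?B"
    let ?L = "merge_rows p T"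
    have label: "with_label j ?L = T j" if "j \<in> {1..p}" for j
      using that T by (intro with_label_merge_rows) (auto simp: PiE_iff)
    have range: "\<forall>x\<in>set ?L. 1 \<le> snd x \<and> snd x \<le> p"
      by (auto simp: set_merge_rows)
    \<comment> \<open>The prescribed numbers \<open>n j\<close> of rows add up to the required
      length \<open>b\<close>.\<close>
    have "length ?L = (\<Sum>j=1..p. length (with_label j ?L))"
      using length_with_label[OF range] by simp
    also have "\<dots> = (\<Sum>j=1..p. n j)"
      using T len label by (intro sum.cong) (auto simp: PiE_iff)
    finally have length: "length ?L = b" using b by simp
    have "\<forall>x\<in>set ?L. fst x \<le> a"
      using T by (auto simp: set_merge_rows PiE_iff)
    then have mem: "map (diagram_row p) ?L \<in> ?A"
      using length range sorted_merge_rows T label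
      by (auto simp: modular_diagram_iff inside_rectangle_def rows_labeled_diagram PiE_iff)
    have "T = ?f (map (diagram_row p) ?L)"
      using T label by (intro ext) (auto simp: rows_labeled_diagram PiE_iff extensional_def)
    then show "T \<in> ?f ` ?A" using mem by (rule image_eqI)
  qed
qed

lemma diagram_size_eq_sum:
  assumes "modular_diagram p k D"
  shows "diagram_size D = (\<Sum>j=1..p. sum_list (rows_labeled D j))"
  using assms sum_list_with_label
  by (auto simp: modular_diagram_iff rows_labeled_diagram diagram_size_diagram)

lemma prod_monom_1:
  "(\<Prod>j\<in>A. monom (1::'a::comm_semiring_1) (f j)) = monom 1 (\<Sum>j\<in>A. f j)"
  by (induction A rule: infinite_finite_induct) (simp_all add: mult_monom)

text \<open>The size is additive over the labels, so each weight factors, and the sum over the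
  product of the sets \<open>R j\<close> becomes a product of sums.\<close>

lemma gen_fun_diagrams:
  fixes a b :: nat and P :: "nat \<Rightarrow> nat list \<Rightarrow> bool"
  assumes len: "\<And>j T. j \<in> {1..p} \<Longrightarrow> P j T \<Longrightarrow> length T = n j"
    and b: "(\<Sum>j=1..p. n j) = b"
  defines "R \<equiv> \<lambda>j. {T. sorted_wrt (\<ge>) T \<and> (\<forall>x\<in>set T. x \<le> a) \<and> P j T}"
  assumes fin: "\<And>j. j \<in> {1..p} \<Longrightarrow> finite (R j)"
  defines "S \<equiv> {D. modular_diagram p b D \<and> inside_rectangle a b D \<and>
                  (\<forall>j\<in>{1..p}. P j (rows_labeled D j))}"
  shows "finite S" and "gen_fun S = (\<Prod>j=1..p. \<Sum>T\<in>R j. monom 1 (sum_list T))"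
proof -
  let ?f = "\<lambda>D. \<lambda>j\<in>{1..p}. rows_labeled D j"
  have bij: "bij_betw ?f S (PiE {1..p} R)"
    unfolding S_def R_def by (rule bij_betw_rows_labeled[OF len b])
  show "finite S"
    unfolding bij_betw_finite[OF bij] using fin by (intro finite_PiE) auto
  have "(\<Prod>j=1..p. \<Sum>T\<in>R j. monom (1::int) (sum_list T)) =
      (\<Sum>T\<in>PiE {1..p} R. \<Prod>j=1..p. monom 1 (sum_list (T j)))"
    using fin by (intro prod_sum_PiE) auto
  also have "\<dots> = (\<Sum>D\<in>S. \<Prod>j=1..p. monom 1 (sum_list (?f D j)))"
    by (rule sum.reindex_bij_betw[OF bij, symmetric])
  also have "\<dots> = (\<Sum>D\<in>S. monom 1 (diagram_size D))"
    by (intro sum.cong) (auto simp: S_def prod_monom_1 diagram_size_eq_sum)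
  finally show "gen_fun S = (\<Prod>j=1..p. \<Sum>T\<in>R j. monom 1 (sum_list T))"
    by (simp add: gen_fun_def)
qed

section \<open>Descents of a partition\<close>

lemma part_eq_0: "length lam < i \<Longrightarrow> part lam i = 0"
  by (simp add: part_def)

lemma sum_part: "(\<Sum>i=1..length xs. part xs i) = sum_list xs"
proof -
  have "(\<Sum>i=1..length xs. part xs i) = (\<Sum>i<length xs. xs ! i)"
    by (rule sum.reindex_bij_witness[of _ Suc "\<lambda>i. i - 1"]) (auto simp: part_def)
  then show ?thesis by (simp add: sum_list_sum_nth atLeast0LessThan)
qed

lemma bij_betw_part:
  assumes "distinct xs"
  shows "bij_betw (part xs) {1..length xs} (set xs)"
proof (rule bij_betw_imageI)
  show "inj_on (part xs) {1..length xs}"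
    using assms by (auto simp: inj_on_def part_def nth_eq_iff_index_eq)
  show "part xs ` {1..length xs} = set xs"
  proof (intro equalityI subsetI)
    fix x assume "x \<in> set xs"
    then obtain i where "i < length xs" "x = xs ! i" by (auto simp: in_set_conv_nth)
    then have "x = part xs (Suc i)" "Suc i \<in> {1..length xs}" by (auto simp: part_def)
    then show "x \<in> part xs ` {1..length xs}" by blast
  qed (auto simp: part_def)
qed

lemma Y_Suc: "Y lam (Suc i) = Y lam i + part lam (Suc i)"
  by (simp add: Y_def)

lemma finite_descents [simp]: "finite (descents lam)"
  by (rule finite_subset[of _ "{1..length lam}"])
     (auto simp: descents_def part_def split: if_splits)

lemma descents_le_length: "d \<in> descents lam \<Longrightarrow> d \<le> length lam"
  by (auto simp: descents_def part_def split: if_splits)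

lemma bij_betw_d_index: "bij_betw (d_index lam) {1..card (descents lam)} (descents lam)"
  using bij_betw_part[of "rev (sorted_list_of_set (descents lam))"]
  by (simp add: d_index_def[abs_def])

context
  fixes lam :: "nat list" and b :: nat
  assumes lam: "is_partition lam b"
begin

lemma part_antimono: "1 \<le> i \<Longrightarrow> i \<le> j \<Longrightarrow> part lam j \<le> part lam i"
  using lam by (cases "i = j") (auto simp: is_partition_def part_def sorted_wrt_iff_nth_less)

lemma part_pos: "1 \<le> i \<Longrightarrow> i \<le> length lam \<Longrightarrow> part lam i > 0"
  using lam by (auto simp: is_partition_def part_def)

lemma length_le_size: "length lam \<le> b"
proof -
  have "(\<Sum>i=1..length lam. 1) \<le> (\<Sum>i=1..length lam. part lam i)"
    using part_pos by (intro sum_mono) (auto simp: Suc_le_eq)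
  then show ?thesis using lam sum_part[of lam] by (simp add: is_partition_def)
qed

text \<open>Each part size occurs for the last time at exactly one descent. Hence the number of
  descents is the number of distinct part sizes.\<close>

lemma bij_betw_descents: "bij_betw (part lam) (descents lam) (set lam)"
proof (rule bij_betw_imageI)
  show "inj_on (part lam) (descents lam)"
  proof (rule linorder_inj_onI)
    fix i j assume "i < j" "i \<in> descents lam" "j \<in> descents lam"
    then have "part lam j \<le> part lam (i + 1)" "part lam (i + 1) < part lam i"
      by (auto simp: descents_def intro: part_antimono)
    then show "part lam i \<noteq> part lam j" by simp
  qed auto
  show "part lam ` descents lam = set lam"
  proof (intro equalityI subsetI)
    fix x assume "x \<in> part lam ` descents lam"
    then show "x \<in> set lam"
      using descents_le_length by (fastforce simp: descents_def part_def)
  next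
    fix x assume x: "x \<in> set lam"
    define I where "I = {i \<in> {1..length lam}. part lam i = x}"
    obtain i where "i < length lam" "x = lam ! i" using x by (auto simp: in_set_conv_nth)
    then have "Suc i \<in> I" by (simp add: I_def part_def)
    then have I: "finite I" "I \<noteq> {}" by (auto simp: I_def)
    \<comment> \<open>The last position of \<open>x\<close>; the following entry is smaller, being 0
      beyond the end of the list.\<close>
    define d where "d = Max I"
    have d: "1 \<le> d" "d \<le> length lam" "part lam d = x"
      using Max_in[OF I] by (auto simp: I_def d_def)
    have "part lam (d + 1) \<noteq> x"
    proof
      assume eq: "part lam (d + 1) = x"
      then have "d + 1 \<le> length lam"
        using part_pos[of d] d by (metis not_le_imp_less part_eq_0 less_irrefl)
      with eq have "d + 1 \<in> I" by (simp add: I_def)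
      then show False using Max_ge[OF I(1), of "d + 1"] by (simp add: d_def)
    qed
    then have "d \<in> descents lam"
      using d part_antimono[of d "d + 1"] by (auto simp: descents_def)
    with d show "x \<in> part lam ` descents lam" by blast
  qed
qed

lemma card_descents: "card (descents lam) = card (set lam)"
  by (rule bij_betw_same_card[OF bij_betw_descents])

text \<open>Abel summation, whose boundary term vanishes at \<open>n = length lam\<close>. It shows
  that the row counts prescribed for the labels add up to \<open>b\<close>.\<close>

lemma sum_mult_at_descents: "(\<Sum>d\<in>descents lam. d * mult_at lam d) = b"
proof -
  have abel: "(\<Sum>d=1..n. d * mult_at lam d) + n * part lam (Suc n) = (\<Sum>d=1..n. part lam d)" for n
  proof (induction n)
    case (Suc n)
    have "part lam (Suc n) = mult_at lam (Suc n) + part lam (Suc (Suc n))"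
      using part_antimono[of "Suc n" "Suc (Suc n)"] by (simp add: mult_at_def)
    then have "Suc n * part lam (Suc n) =
        Suc n * mult_at lam (Suc n) + Suc n * part lam (Suc (Suc n))"
      by (simp only: distrib_left)
    with Suc show ?case by simp
  qed simp
  have "(\<Sum>d\<in>descents lam. d * mult_at lam d) = (\<Sum>d=1..length lam. d * mult_at lam d)"
    using descents_le_length
    by (intro sum.mono_neutral_left) (auto simp: descents_def mult_at_def)
  also have "\<dots> = b"
    using abel[of "length lam"] lam sum_part[of lam] by (simp add: part_eq_0 is_partition_def)
  finally show ?thesis .
qed

lemma Y_le_mult_first: "Y lam j \<le> j * part lam 1"
proof -
  have "Y lam j \<le> (\<Sum>i=1..j. part lam 1)"
    unfolding Y_def by (intro sum_mono part_antimono) auto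
  then show ?thesis by simp
qed

text \<open>The second difference of \<open>Y\<close> at \<open>j\<close> is
  \<open>part lam (j + 1) - part lam j\<close>. This form of the index separates the lower index
  \<open>mult_at lam j\<close> from a term to be matched with a box height.\<close>

lemma F_factor_upper_index:
  assumes "j \<ge> 1"
  shows "int (j * (a + 2)) - int (Y lam (j - 1)) - int (Y lam (j + 1)) =
    int (j * (a + 2)) - 2 * int (Y lam j) + int (mult_at lam j)"
proof -
  have "Y lam j = Y lam (j - 1) + part lam j" "Y lam (j + 1) = Y lam j + part lam (j + 1)"
    using Y_Suc[of lam "j - 1"] Y_Suc[of lam j] assms by simp_all
  then show ?thesis
    using part_antimono[of j "j + 1"] assms by (simp add: mult_at_def of_nat_diff)
qed

text \<open>
  A factor at a non-descent is 1, except that it is 0 when its upper index is negative.  The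
  latter forces \<open>2 * part lam 1 > a + 2\<close>, and then the factor at the smallest descent is 0 as well.
\<close>

lemma prod_F_factor_descents:
  assumes "b > 0"
  shows "(\<Prod>j=1..b. F_factor a lam j) = (\<Prod>d\<in>descents lam. F_factor a lam d)"
proof -
  have sub: "descents lam \<subseteq> {1..b}"
    using descents_le_length length_le_size by (fastforce simp: descents_def)
  show ?thesis
  proof (cases "2 * part lam 1 \<le> a + 2")
    case True
    show ?thesis
    proof (rule prod.mono_neutral_right[OF _ sub]; (intro ballI)?)
      fix j assume j: "j \<in> {1..b} - descents lam"
      then have m: "mult_at lam j = 0" by (auto simp: descents_def mult_at_def)
      have "2 * Y lam j \<le> j * (2 * part lam 1)"
        using Y_le_mult_first[of j] by simp
      also have "\<dots> \<le> j * (a + 2)" using True by (rule mult_le_mono2)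
      finally have "0 \<le> int (j * (a + 2)) - 2 * int (Y lam j)" by linarith
      then show "F_factor a lam j = 1"
        using j m F_factor_upper_index[of j a] unfolding F_factor_def mult_at_def
        by (simp add: gauss_poly_0)
    qed simp
  next
    case False
    have "set lam \<noteq> {}" using lam \<open>b > 0\<close> by (auto simp: is_partition_def)
    then have ne: "descents lam \<noteq> {}" using bij_betw_descents by (auto simp: bij_betw_def)
    define d where "d = Min (descents lam)"
    have d: "d \<in> descents lam" using ne by (simp add: d_def)
    then have "d \<ge> 1" by (simp add: descents_def)
    \<comment> \<open>No descent precedes \<open>d\<close>, so the parts are constant up to position
      \<open>d\<close>.\<close>
    have const: "part lam i = part lam 1" if "1 \<le> i" "i \<le> d" for i
      using that
    proof (induction i rule: dec_induct)
      case (step n)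
      have "n \<notin> descents lam"
      proof
        assume "n \<in> descents lam"
        then have "d \<le> n" by (simp add: d_def)
        with step show False by simp
      qed
      then show ?case
        using step part_antimono[of n "Suc n"] by (simp add: descents_def)
    qed simp
    have "Y lam d = (\<Sum>i=1..d. part lam 1)"
      unfolding Y_def by (intro sum.cong const) auto
    then have "Y lam d = d * part lam 1" by simp
    moreover have "d * (a + 2) < d * (2 * part lam 1)"
      using False \<open>d \<ge> 1\<close> by (intro mult_less_mono2) auto
    ultimately have "int (d * (a + 2)) - 2 * int (Y lam d) < 0" by linarith
    \<comment> \<open>The upper index is this negative number plus the lower index
      \<open>mult_at lam d\<close>.\<close>
    then have zero: "F_factor a lam d = 0"
      using F_factor_upper_index[OF \<open>d \<ge> 1\<close>, of a]
      by (simp add: F_factor_def gauss_poly_def mult_at_def)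
    have "(\<Prod>j=1..b. F_factor a lam j) = 0"
      using d sub zero by (intro prod_zero) auto
    moreover have "(\<Prod>d\<in>descents lam. F_factor a lam d) = 0"
      using d zero by (intro prod_zero) auto
    ultimately show ?thesis by (simp only:)
  qed
qed

end

theorem theorem3p7:
  fixes a b p :: nat and lam :: "nat list" and \<gamma> :: "nat \<Rightarrow> nat list"
  assumes "a > 0" and "b > 0"
    and "is_partition lam b"
    and "p = card (set lam)"
    and "\<forall>j\<in>{1..p}. length (\<gamma> (d_index lam j)) = mult_at lam (d_index lam j)"
    and "\<forall>j\<in>{1..p}. sorted_wrt (>) (\<gamma> (d_index lam j))"
    and "\<forall>j\<in>{1..p}. part (\<gamma> (d_index lam j)) (mult_at lam (d_index lam j)) = 0"
    and "\<forall>j\<in>{1..p}. real (part (\<gamma> (d_index lam j)) 1)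
           = - 2 + 2 * real (Y lam (d_index lam j)) / real (d_index lam j)"
    and "(\<Sum>j=1..p. \<Sum>h=1..mult_at lam (d_index lam j). d_index lam j * part (\<gamma> (d_index lam j)) h)
           = 2 * (\<Sum>i=1..length lam. part lam i choose 2)"
  shows "finite (admissible_diagrams a b p lam \<gamma>) \<and>
         F_poly a lam = gen_fun (admissible_diagrams a b p lam \<gamma>)"
proof -
  note lam = assms(3)
  define d where "d = d_index lam"
  define m where "m j = mult_at lam (d j)" for j
  define g where "g j = \<gamma> (d j)" for j
  have bij: "bij_betw d {1..p} (descents lam)"
    using bij_betw_d_index[of lam] card_descents[OF lam] assms(4) by (simp add: d_def)
  have descent: "d j \<in> descents lam" if "j \<in> {1..p}" for j
    using bij_betwE[OF bij] that by blast
  have dm: "d j > 0" "m j > 0" if "j \<in> {1..p}" for j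
    using descent[OF that] by (auto simp: descents_def m_def mult_at_def)
  have len_g: "length (g j) = m j" if "j \<in> {1..p}" for j
    using assms(5) that by (simp add: g_def m_def d_def)
  have rows: "(\<Sum>T\<in>label_rows a (d j) (m j) (g j). monom (1::int) (sum_list T)) =
      monom 1 (d j * sum_list (g j)) * F_factor a lam (d j)" if j: "j \<in> {1..p}" for j
  proof -
    have first: "part (g j) 1 = g j ! 0" and last: "part (g j) (m j) = g j ! (m j - 1)"
      using len_g[OF j] dm[OF j] by (simp_all add: part_def Suc_le_eq)
    have "real (g j ! 0) = - 2 + 2 * real (Y lam (d j)) / real (d j)"
      using assms(8) j first unfolding d_def g_def by metis
    \<comment> \<open>Clearing the denominator turns the condition on the first part of
      \<open>g j\<close> into an identity between integers.\<close>
    then have "real (d j) * real (g j ! 0) = real (d j) * (- 2) + 2 * real (Y lam (d j))"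
      using dm[OF j] by (simp add: field_simps)
    then have "real_of_int (int (d j) * int (g j ! 0)) =
        real_of_int (2 * int (Y lam (d j)) - 2 * int (d j))" by simp
    then have "int (d j) * int (g j ! 0) = 2 * int (Y lam (d j)) - 2 * int (d j)"
      by (simp only: of_int_eq_iff)
    \<comment> \<open>Substituting \<open>2 * Y - 2 * d\<close> for \<open>d\<close> times the first
      part of \<open>g j\<close> turns \<open>d * (a - g ! 0)\<close> into
      \<open>d * (a + 2) - 2 * Y\<close>.\<close>
    then have upper: "int (d j) * (int a - int (g j ! 0)) + int (m j) =
        int (d j * (a + 2)) - int (Y lam (d j - 1)) - int (Y lam (d j + 1))"
      using F_factor_upper_index[OF lam, of "d j" a] dm[OF j]
      by (simp add: m_def algebra_simps)
    have "g j ! (m j - 1) = 0"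
      using assms(7) j last by (simp add: g_def m_def d_def)
    moreover have "sorted_wrt (>) (g j)" using assms(6) j by (simp add: g_def d_def)
    ultimately show ?thesis
      using label_rows_generating_function[OF dm[OF j] len_g[OF j], of a] upper
      by (simp add: F_factor_def m_def mult_at_def)
  qed
  have shift: "(\<Sum>j=1..p. d j * sum_list (g j)) = shift lam"
  proof -
    have "d j * sum_list (g j) = (\<Sum>h=1..m j. d j * part (g j) h)" if "j \<in> {1..p}" for j
      using sum_part[of "g j"] len_g[OF that] by (simp flip: sum_distrib_left)
    then have "(\<Sum>j=1..p. d j * sum_list (g j)) = (\<Sum>j=1..p. \<Sum>h=1..m j. d j * part (g j) h)"
      by (intro sum.cong) auto
    then show ?thesis
      using assms(9) by (simp add: shift_def d_def m_def g_def)
  qed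
  have size: "(\<Sum>j=1..p. d j * m j) = b"
    using sum.reindex_bij_betw[OF bij, of "\<lambda>d. d * mult_at lam d"] sum_mult_at_descents[OF lam]
    by (simp add: m_def)
  let ?P = "\<lambda>j. row_conditions (d j) (m j) (g j)"
  have admissible: "admissible_diagrams a b p lam \<gamma> =
      {D. modular_diagram p b D \<and> inside_rectangle a b D \<and> (\<forall>j\<in>{1..p}. ?P j (rows_labeled D j))}"
    by (simp add: admissible_diagrams_def d_def m_def g_def)
  have len: "length T = d j * m j" if "?P j T" for j T
    using that by (simp add: row_conditions_def)
  note diagrams = gen_fun_diagrams[where P = ?P and n = "\<lambda>j. d j * m j" and a = a, OF len size,
      folded label_rows_def admissible]
  \<comment> \<open>The product over all positions shrinks to the descents, which the labels
    \<open>1..p\<close> enumerate; \<open>shift lam\<close> is then distributed over the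
    labels.\<close>
  have "F_poly a lam = monom 1 (shift lam) * (\<Prod>j=1..p. F_factor a lam (d j))"
    by (simp only: F_poly_finite_prod[OF lam] prod_F_factor_descents[OF lam \<open>b > 0\<close>]
        prod.reindex_bij_betw[OF bij])
  also have "monom 1 (shift lam) = (\<Prod>j=1..p. monom (1::int) (d j * sum_list (g j)))"
    by (simp only: prod_monom_1 shift)
  also have "\<dots> * (\<Prod>j=1..p. F_factor a lam (d j)) =
      (\<Prod>j=1..p. \<Sum>T\<in>label_rows a (d j) (m j) (g j). monom 1 (sum_list T))"
    using rows by (simp add: prod.distrib)
  also have "\<dots> = gen_fun (admissible_diagrams a b p lam \<gamma>)"
    by (rule diagrams(2)[symmetric]) auto
  finally show ?thesis using diagrams(1) by simp
qed

end
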